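(* Let $(X_i)_{i=1}^\infty$ be independent with $X_i\sim\mathrm{Exp}(i)$ and $M=\sup_{i\ge1}X_i$. Then as $m\to\infty$, $$P(X_m=M)=\pi\sqrt{2m}\;e^{-\pi\sqrt{2/3}\,\sqrt m}\,(1+o(1)).$$
   Context: $\mathrm{Exp}(\lambda)$ denotes the exponential distribution with rate $\lambda$ (density $\lambda e^{-\lambda x}$, $x\ge0$). *)

theory Defs
  imports "HOL-Probability.Probability" "HOL-Library.Landau_Symbols"
begin

end

theory Submission
  imports Defs "HOL-Real_Asymp.Real_Asymp"
begin

text \<open>
  Let \<open>\<phi> q = \<Prod>(1 - q ^ i)\<close> be Euler's function, so that \<open>P(M \<le> x) = \<phi> (exp (- x))\<close>. Conditioning
  on \<open>X\<^sub>m\<close>, the probability is \<open>m\<close> times the Laplace transform at \<open>m\<close> of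
  \<open>G x = P(X\<^sub>i \<le> x for all i \<noteq> m)\<close>. Since \<open>(1 - exp (- m x)) G x = \<phi> (exp (- x))\<close>, it equals
  \<open>m \<Sum> L (r m)\<close> over \<open>r \<ge> 1\<close>, where \<open>L\<close> is the Laplace transform of \<open>\<phi> (exp (- x))\<close>. By the
  pentagonal number theorem, \<open>L s\<close> is the sum over all integers \<open>k\<close> of
  \<open>(-1)\<^sup>k / (s + k (3 k - 1) / 2)\<close>, which the partial fraction expansion of \<open>\<pi> / sin (\<pi> z)\<close>
  evaluates in closed form. The term \<open>r = 1\<close> gives the asymptotics, and the terms \<open>r \<ge> 2\<close> are
  exponentially smaller.
\<close>

subsection \<open>The pentagonal number theorem\<close>

definition pentagonal_number :: "int \<Rightarrow> nat" where
  "pentagonal_number k = nat (k * (3 * k - 1) div 2)"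

lemma double_pentagonal_number: "2 * int (pentagonal_number k) = k * (3 * k - 1)"
proof -
  have "even (k * (3 * k - 1))" by simp
  moreover have "0 \<le> k * (3 * k - 1)" by (auto simp: zero_le_mult_iff)
  ultimately show ?thesis by (simp add: pentagonal_number_def)
qed

lemma pentagonal_number_eqI: "2 * int n = k * (3 * k - 1) \<Longrightarrow> pentagonal_number k = n"
  by (simp add: pentagonal_number_def flip: mult_cancel_left[of 2])

lemma of_nat_pentagonal_number:
  "of_nat (pentagonal_number k) = (of_int k * (3 * of_int k - 1) / 2 :: 'a :: field_char_0)"
proof -
  have "of_int (2 * int (pentagonal_number k)) = (of_int (k * (3 * k - 1)) :: 'a)"
    unfolding double_pentagonal_number ..
  thus ?thesis by (simp add: mult.commute)
qed

lemma square_le_pentagonal_number: "(nat \<bar>k\<bar>)\<^sup>2 \<le> pentagonal_number k"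
proof -
  have "k \<le> k * k"
  proof (cases "k \<le> 0")
    case True
    thus ?thesis using zero_le_square[of k] by linarith
  qed simp
  hence "2 * k\<^sup>2 \<le> k * (3 * k - 1)" by (simp add: power2_eq_square algebra_simps)
  hence "k\<^sup>2 \<le> int (pentagonal_number k)" using double_pentagonal_number[of k] by simp
  thus ?thesis by (simp flip: of_nat_le_iff[where 'a = int])
qed

lemma le_pentagonal_number: "nat \<bar>k\<bar> \<le> pentagonal_number k"
  using square_le_pentagonal_number[of k] power2_nat_le_imp_le by blast

definition shanks_term :: "'a :: comm_ring_1 \<Rightarrow> nat \<Rightarrow> nat \<Rightarrow> 'a" where
  "shanks_term q n s = (-1) ^ s * (\<Prod>i=Suc s..n. 1 - q ^ i) * q ^ (s * n + s * (s + 1) div 2)"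

text \<open>The factor \<open>i = 0\<close> of the product makes this vanish at \<open>s = 0\<close>.\<close>

definition shanks_antidifference :: "'a :: comm_ring_1 \<Rightarrow> nat \<Rightarrow> nat \<Rightarrow> 'a" where
  "shanks_antidifference q n s =
     (-1) ^ s * (\<Prod>i=s..n. 1 - q ^ i) * q ^ (s * n + s * (s + 1) div 2)"

lemma shanks_term_Suc_diff:
  fixes q :: "'a :: comm_ring_1"
  assumes "s \<le> n"
  shows "shanks_term q (Suc n) s - shanks_term q n s =
           shanks_antidifference q n (Suc s) - shanks_antidifference q n s"
proof -
  define P E where "P = (\<Prod>i=Suc s..n. 1 - q ^ i)" and "E = q ^ (s * n + s * (s + 1) div 2)"
  have "shanks_term q n s = (-1) ^ s * P * E"
    by (simp add: shanks_term_def P_def E_def)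
  moreover have "(\<Prod>i=Suc s..Suc n. 1 - q ^ i) = P * (1 - q ^ Suc n)"
    using assms by (simp add: P_def prod.nat_ivl_Suc')
  hence "shanks_term q (Suc n) s = (-1) ^ s * P * E * q ^ s * (1 - q ^ Suc n)"
    unfolding shanks_term_def E_def by (simp only: mult_Suc_right power_add) (simp add: mult_ac)
  moreover have "shanks_antidifference q n s = (-1) ^ s * (1 - q ^ s) * P * E"
    unfolding shanks_antidifference_def prod.atLeast_Suc_atMost[OF assms]
    by (simp add: P_def E_def mult_ac)
  moreover have "shanks_antidifference q n (Suc s) = (-1) ^ Suc s * P * E * q ^ s * q ^ Suc n"
  proof -
    have exponent:
      "Suc s * n + Suc s * (Suc s + 1) div 2 = (s * n + s * (s + 1) div 2) + s + Suc n"
      by simp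
    show ?thesis
      unfolding shanks_antidifference_def exponent P_def E_def power_add by (simp add: mult_ac)
  qed
  ultimately show ?thesis by (simp add: algebra_simps)
qed

lemma sum_shanks_term_Suc:
  fixes q :: "'a :: comm_ring_1"
  shows "(\<Sum>s\<le>Suc n. shanks_term q (Suc n) s) = (\<Sum>s\<le>n. shanks_term q n s) + (-1) ^ Suc n *
           (q ^ pentagonal_number (int n + 1) + q ^ pentagonal_number (- int (Suc n)))"
proof -
  let ?G = "shanks_antidifference q n"
  have "(\<Sum>s\<le>n. shanks_term q (Suc n) s - shanks_term q n s) = (\<Sum>s<Suc n. ?G (Suc s) - ?G s)"
    by (intro sum.cong shanks_term_Suc_diff) auto
  also have "\<dots> = ?G (Suc n) - ?G 0" by (rule sum_lessThan_telescope)
  also have "?G 0 = 0" by (simp add: shanks_antidifference_def prod.atLeast_Suc_atMost)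
  also have "?G (Suc n) = (-1) ^ Suc n * q ^ pentagonal_number (int n + 1)"
  proof -
    have "pentagonal_number (int n + 1) = Suc n * n + Suc n * (Suc n + 1) div 2"
      by (rule pentagonal_number_eqI) (simp add: zdiv_int algebra_simps)
    thus ?thesis by (simp add: shanks_antidifference_def del: mult_Suc)
  qed
  finally have "(\<Sum>s\<le>n. shanks_term q (Suc n) s) =
      (\<Sum>s\<le>n. shanks_term q n s) + (-1) ^ Suc n * q ^ pentagonal_number (int n + 1)"
    by (simp add: sum_subtractf algebra_simps)
  moreover have "shanks_term q (Suc n) (Suc n) =
      (-1) ^ Suc n * q ^ pentagonal_number (- int (Suc n))"
  proof -
    have "pentagonal_number (- int (Suc n)) = Suc n * Suc n + Suc n * (Suc n + 1) div 2"
      by (rule pentagonal_number_eqI) (simp add: zdiv_int algebra_simps)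
    thus ?thesis by (simp add: shanks_term_def del: mult_Suc)
  qed
  ultimately show ?thesis by (simp add: algebra_simps)
qed

text \<open>Pairing \<open>k = - j\<close> with \<open>k = j + 1\<close>, rather than with \<open>k = j\<close>, treats all terms alike and
  matches the expansion of the cosecant.\<close>

definition pentagonal_term :: "'a :: comm_ring_1 \<Rightarrow> nat \<Rightarrow> 'a" where
  "pentagonal_term q j =
     (-1) ^ j * (q ^ pentagonal_number (- int j) - q ^ pentagonal_number (int j + 1))"

lemma shanks_identity:
  "(\<Sum>s\<le>n. shanks_term q n s) =
     (\<Sum>j<n. pentagonal_term q j) + (-1) ^ n * q ^ pentagonal_number (- int n)"
proof (induction n)
  case 0
  show ?case by (simp add: shanks_term_def pentagonal_number_def)
next
  case (Suc n)
  thus ?case unfolding sum_shanks_term_Suc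
    by (simp add: pentagonal_term_def algebra_simps)
qed

lemma summable_norm_pentagonal_term:
  fixes q :: "'a :: real_normed_field"
  assumes "norm q < 1"
  shows "summable (\<lambda>j. norm (pentagonal_term q j))"
proof (rule summable_comparison_test')
  show "summable (\<lambda>j. 2 * norm q ^ j)"
    using assms by (intro summable_mult summable_geometric) auto
  fix j :: nat
  have "norm (pentagonal_term q j) =
      norm (q ^ pentagonal_number (- int j) - q ^ pentagonal_number (int j + 1))"
    by (simp add: pentagonal_term_def norm_mult norm_power)
  also have "\<dots> \<le> norm q ^ pentagonal_number (- int j) + norm q ^ pentagonal_number (int j + 1)"
    by (metis norm_power norm_triangle_ineq4)
  also have "\<dots> \<le> norm q ^ j + norm q ^ j"
    using assms le_pentagonal_number[of "- int j"] le_pentagonal_number[of "int j + 1"]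
    by (intro add_mono power_decreasing) auto
  finally show "norm (norm (pentagonal_term q j)) \<le> 2 * norm q ^ j" by simp
qed

lemma norm_prod_one_minus_power_le:
  fixes q :: "'a :: real_normed_field"
  assumes "norm q < 1" "finite A"
  shows "norm (\<Prod>i\<in>A. 1 - q ^ i) \<le> exp (1 / (1 - norm q))"
proof -
  have "norm (\<Prod>i\<in>A. 1 - q ^ i) = (\<Prod>i\<in>A. norm (1 - q ^ i))" by (rule prod_norm[symmetric])
  also have "\<dots> \<le> (\<Prod>i\<in>A. 1 + norm q ^ i)"
    by (intro prod_mono) (metis norm_ge_zero norm_one norm_power norm_triangle_ineq4)
  also have "\<dots> \<le> exp (\<Sum>i\<in>A. norm q ^ i)" by (rule prod_le_exp_sum) auto
  also have "(\<Sum>i\<in>A. norm q ^ i) \<le> 1 / (1 - norm q)"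
    using assms sum_le_suminf[of "\<lambda>i. norm q ^ i" A]
    by (simp add: suminf_geometric summable_geometric)
  finally show ?thesis by simp
qed

definition euler_function :: "'a :: real_normed_field \<Rightarrow> 'a" where
  "euler_function q = (\<Prod>i. 1 - q ^ Suc i)"

lemma has_prod_euler_function:
  fixes q :: "'a :: {real_normed_field, banach}"
  assumes "norm q < 1"
  shows "(\<lambda>i. 1 - q ^ Suc i) has_prod euler_function q"
proof -
  have "summable (\<lambda>i. norm (1 - q ^ Suc i - 1))"
    using assms by (simp add: norm_mult norm_power summable_mult summable_geometric)
  thus ?thesis unfolding euler_function_def
    by (intro convergent_prod_has_prod abs_convergent_prod_imp_convergent_prod
        summable_imp_abs_convergent_prod)
qed

lemma shanks_remainder_tendsto_0:
  fixes q :: "'a :: real_normed_field"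
  assumes "norm q < 1"
  shows "(\<lambda>n. \<Sum>s=1..n. shanks_term q n s) \<longlonglongrightarrow> 0"
proof (rule Lim_null_comparison)
  define C where "C = exp (1 / (1 - norm q))"
  show "(\<lambda>n. C * (real n * norm q ^ n)) \<longlonglongrightarrow> 0"
    using powser_times_n_limit_0[of "norm q"] assms by (intro tendsto_mult_right_zero) simp
  have "norm (\<Sum>s=1..n. shanks_term q n s) \<le> (\<Sum>s=1..n. C * norm q ^ n)" for n
  proof (rule sum_norm_le)
    fix s assume s: "s \<in> {1..n}"
    have "norm (shanks_term q n s) =
        norm (\<Prod>i=Suc s..n. 1 - q ^ i) * norm q ^ (s * n + s * (s + 1) div 2)"
      by (simp add: shanks_term_def norm_mult norm_power)
    also have "\<dots> \<le> C * norm q ^ n"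
      unfolding C_def using assms s
      by (intro mult_mono norm_prod_one_minus_power_le power_decreasing) (auto simp: trans_le_add1)
    finally show "norm (shanks_term q n s) \<le> C * norm q ^ n" .
  qed
  thus "\<forall>\<^sub>F n in sequentially. norm (\<Sum>s=1..n. shanks_term q n s) \<le> C * (real n * norm q ^ n)"
    by (simp add: mult_ac)
qed

theorem pentagonal_number_theorem:
  fixes q :: "'a :: {real_normed_field, banach}"
  assumes "norm q < 1"
  shows "euler_function q = (\<Sum>j. pentagonal_term q j)"
proof -
  have product: "(\<Prod>i<n. 1 - q ^ Suc i) = (\<Sum>j<n. pentagonal_term q j) +
      (-1) ^ n * q ^ pentagonal_number (- int n) - (\<Sum>s=1..n. shanks_term q n s)" for n
  proof -
    have "(\<Sum>s\<le>n. shanks_term q n s) = shanks_term q n 0 + (\<Sum>s=1..n. shanks_term q n s)"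
      by (simp add: sum.atMost_shift sum.atLeast1_atMost_eq)
    moreover have "shanks_term q n 0 = (\<Prod>i<n. 1 - q ^ Suc i)"
      by (simp add: shanks_term_def prod.atLeast1_atMost_eq del: power_Suc)
    ultimately show ?thesis by (simp add: shanks_identity)
  qed
  have last: "(\<lambda>n. (-1) ^ n * q ^ pentagonal_number (- int n)) \<longlonglongrightarrow> 0"
  proof (rule Lim_null_comparison)
    show "(\<lambda>n. norm q ^ n) \<longlonglongrightarrow> 0" using assms by (intro LIMSEQ_power_zero) auto
    show "\<forall>\<^sub>F n in sequentially. norm ((-1) ^ n * q ^ pentagonal_number (- int n)) \<le> norm q ^ n"
      using assms le_pentagonal_number[of "- int n" for n]
      by (auto simp: norm_mult norm_power intro!: always_eventually power_decreasing)
  qed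
  have "(\<lambda>n. \<Prod>i<n. 1 - q ^ Suc i) \<longlonglongrightarrow> (\<Sum>j. pentagonal_term q j) + 0 - 0"
    unfolding product using summable_norm_cancel[OF summable_norm_pentagonal_term[OF assms]]
    by (intro tendsto_intros summable_LIMSEQ last shanks_remainder_tendsto_0 assms)
  moreover have "(\<lambda>n. \<Prod>i<n. 1 - q ^ Suc i) \<longlonglongrightarrow> euler_function q"
    by (rule has_prod_imp_tendsto'[OF has_prod_euler_function[OF assms]])
  ultimately show ?thesis using LIMSEQ_unique by fastforce
qed

subsection \<open>Partial fractions of the cosecant\<close>

lemma Digamma_reflection_complex:
  fixes z :: complex
  assumes "z \<notin> \<int>"
  shows "Digamma (1 - z) - Digamma z = of_real pi * cot (of_real pi * z)"
proof -
  have nonpole: "z \<notin> \<int>\<^sub>\<le>\<^sub>0" "1 - z \<notin> \<int>\<^sub>\<le>\<^sub>0"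
    using assms nonpos_Ints_subset_Ints Ints_diff[of 1 "1 - z"] by auto
  have sin: "sin (of_real pi * z) \<noteq> 0"
    using assms by (auto simp: sin_eq_0 elim!: Ints_cases)
  have "((\<lambda>z. Gamma z * Gamma (1 - z)) has_field_derivative
       Gamma z * Gamma (1 - z) * (Digamma z - Digamma (1 - z))) (at z)"
    using nonpole by (auto intro!: derivative_eq_intros simp: algebra_simps)
  moreover have "((\<lambda>z. of_real pi / sin (of_real pi * z)) has_field_derivative
       - (of_real pi / sin (of_real pi * z) * (of_real pi * cot (of_real pi * z)))) (at z)"
    using sin by (auto intro!: derivative_eq_intros simp: cot_def)
  ultimately have "Gamma z * Gamma (1 - z) * (Digamma z - Digamma (1 - z)) =
       Gamma z * Gamma (1 - z) * (- (of_real pi * cot (of_real pi * z)))"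
    unfolding Gamma_reflection_complex using DERIV_unique by fastforce
  moreover have "Gamma z * Gamma (1 - z) \<noteq> 0"
    using sin by (simp add: Gamma_reflection_complex)
  ultimately have "Digamma z - Digamma (1 - z) = - (of_real pi * cot (of_real pi * z))"
    by (metis mult_left_cancel)
  thus ?thesis by (simp add: algebra_simps)
qed

lemma sums_pairs_imp_sums:
  fixes f :: "nat \<Rightarrow> 'a :: real_normed_vector"
  assumes "(\<lambda>n. f (2 * n) + f (2 * n + 1)) sums s" and "f \<longlonglongrightarrow> 0"
  shows "f sums s"
proof -
  have "(\<Sum>i<2 * n. f i) = (\<Sum>i<n. f (2 * i) + f (2 * i + 1))" for n
    by (induction n) auto
  hence even: "(\<lambda>n. \<Sum>i<2 * n. f i) \<longlonglongrightarrow> s"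
    using assms(1) by (simp add: sums_def)
  have "(\<lambda>n. f (2 * n)) \<longlonglongrightarrow> 0"
    using LIMSEQ_subseq_LIMSEQ[OF assms(2), of "\<lambda>n. 2 * n"] by (simp add: strict_mono_def o_def)
  from tendsto_add[OF even this] have odd: "(\<lambda>n. \<Sum>i<2 * n + 1. f i) \<longlonglongrightarrow> s"
    by simp
  show ?thesis unfolding sums_def using even odd by (rule limseq_even_odd)
qed

lemma alternating_harmonic_sums_Digamma:
  fixes z :: "'a :: {real_normed_field, banach}"
  assumes "z \<notin> \<int>\<^sub>\<le>\<^sub>0"
  shows "(\<lambda>n. (-1) ^ n / (z + of_nat n)) sums ((Digamma ((z + 1) / 2) - Digamma (z / 2)) / 2)"
proof (rule sums_pairs_imp_sums)
  have digamma_sums: "(\<lambda>k. inverse (of_nat (Suc k)) - inverse (w + of_nat k)) sums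
      (Digamma w + euler_mascheroni)" if "w \<noteq> 0" for w :: 'a
    using summable_sums[OF summable_Digamma[OF that]] by (simp add: Digamma_def)
  have "z / 2 \<noteq> 0" "(z + 1) / 2 \<noteq> 0"
    using assms by (auto simp: add_eq_0_iff2)
  from sums_divide[OF sums_diff[OF digamma_sums[OF this(2)] digamma_sums[OF this(1)]], of 2]
  have "(\<lambda>n. (inverse (z / 2 + of_nat n) - inverse ((z + 1) / 2 + of_nat n)) / 2) sums
      ((Digamma ((z + 1) / 2) - Digamma (z / 2)) / 2)"
    by simp
  moreover have "z / 2 + of_nat n = (z + of_nat (2 * n)) / 2"
    and "(z + 1) / 2 + of_nat n = (z + of_nat (2 * n + 1)) / 2" for n
    by (simp_all add: field_simps)
  moreover have halve_difference: "(inverse (a / 2) - inverse (b / 2)) / 2 = 1 / a - 1 / b"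
    for a b :: 'a
    by (simp add: diff_divide_distrib)
  ultimately show "(\<lambda>n. (-1) ^ (2 * n) / (z + of_nat (2 * n)) +
      (-1) ^ (2 * n + 1) / (z + of_nat (2 * n + 1))) sums
      ((Digamma ((z + 1) / 2) - Digamma (z / 2)) / 2)"
    by (simp only: halve_difference) simp
  have "(\<lambda>n. inverse (z + of_nat n)) \<longlonglongrightarrow> 0"
    by (intro filterlim_compose[OF tendsto_inverse_0] tendsto_of_nat
        tendsto_add_filterlim_at_infinity[OF tendsto_const])
  thus "(\<lambda>n. (-1) ^ n / (z + of_nat n)) \<longlonglongrightarrow> 0"
    by (rule Lim_null_comparison[rotated, OF tendsto_norm_zero])
       (simp add: norm_divide norm_mult norm_power norm_inverse divide_inverse)
qed

lemma cosecant_eq_Digamma: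
  fixes z :: complex
  assumes "z \<notin> \<int>"
  shows "of_real pi / sin (of_real pi * z) =
           (Digamma ((z + 1) / 2) - Digamma (z / 2)) / 2 +
           (Digamma (1 - z / 2) - Digamma (1 - (z + 1) / 2)) / 2"
proof -
  define w where "w = of_real pi * (z / 2)"
  have half: "z / 2 \<notin> \<int>" using assms Ints_mult[of 2 "z / 2"] by auto
  have half_succ: "(z + 1) / 2 \<notin> \<int>"
  proof
    assume "(z + 1) / 2 \<in> \<int>"
    hence "2 * ((z + 1) / 2) - 1 \<in> \<int>" by (intro Ints_diff Ints_mult) auto
    thus False using assms by (simp add: field_simps)
  qed
  have double: "2 * w = of_real pi * z" by (simp add: w_def)
  have "(Digamma ((z + 1) / 2) - Digamma (z / 2)) / 2 +
      (Digamma (1 - z / 2) - Digamma (1 - (z + 1) / 2)) / 2 =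
      (of_real pi * cot w - of_real pi * cot (w + of_real pi / 2)) / 2"
    using Digamma_reflection_complex[OF half] Digamma_reflection_complex[OF half_succ]
    by (simp add: w_def ring_distribs add_divide_distrib diff_divide_distrib algebra_simps)
  also have "\<dots> = of_real pi * (cos w / sin w + sin w / cos w) / 2"
    by (simp add: cot_def sin_add cos_add ring_distribs)
  also have "cos w / sin w + sin w / cos w = 1 / (sin w * cos w)"
  proof -
    have "sin (2 * w) \<noteq> 0"
      unfolding double using assms by (auto simp: sin_eq_0 elim!: Ints_cases)
    hence "sin w \<noteq> 0" "cos w \<noteq> 0" by (auto simp: sin_double)
    thus ?thesis by (simp add: field_simps flip: power2_eq_square)
  qed
  also have "of_real pi * (1 / (sin w * cos w)) / 2 = of_real pi / sin (of_real pi * z)"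
    by (simp add: sin_double flip: double)
  finally show ?thesis ..
qed

theorem cosecant_partial_fractions:
  fixes z :: complex
  assumes "z \<notin> \<int>"
  shows "(\<lambda>n. (-1) ^ n * (1 / (z + of_nat n) - 1 / (z - of_nat (Suc n)))) sums
           (of_real pi / sin (of_real pi * z))"
proof -
  have "1 - z \<notin> \<int>" using assms Ints_diff[of 1 "1 - z"] by auto
  hence "(\<lambda>n. (-1) ^ n / (z + of_nat n) + (-1) ^ n / (1 - z + of_nat n)) sums
      ((Digamma ((z + 1) / 2) - Digamma (z / 2)) / 2 +
       (Digamma ((1 - z + 1) / 2) - Digamma ((1 - z) / 2)) / 2)"
    using assms nonpos_Ints_subset_Ints
    by (intro sums_add alternating_harmonic_sums_Digamma) auto
  moreover have "(1 - z + 1) / 2 = 1 - z / 2" "(1 - z) / 2 = 1 - (z + 1) / 2"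
    by (simp_all add: field_simps)
  moreover have "(-1) ^ n / (z + of_nat n) + (-1) ^ n / (1 - z + of_nat n) =
      (-1) ^ n * (1 / (z + of_nat n) - 1 / (z - of_nat (Suc n)))" for n
  proof -
    have "1 - z + of_nat n = - (z - of_nat (Suc n))" by simp
    thus ?thesis by (simp only: divide_minus_right right_diff_distrib) simp
  qed
  ultimately show ?thesis by (simp only: cosecant_eq_Digamma[OF assms])
qed

subsection \<open>Laplace transforms\<close>

definition laplace_transform :: "(real \<Rightarrow> real) \<Rightarrow> real \<Rightarrow> real" where
  "laplace_transform f s = (LBINT x:{0<..}. exp (- (x * s)) * f x)"

lemma laplace_transform_cong:
  "(\<And>x. x > 0 \<Longrightarrow> f x = g x) \<Longrightarrow> laplace_transform f s = laplace_transform g s"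
  unfolding laplace_transform_def by (intro set_lebesgue_integral_cong) auto

lemma laplace_transform_exp:
  assumes "s + a > 0"
  shows "set_integrable lborel {0<..} (\<lambda>x. exp (- (x * s)) * exp (- (x * a)))"
    and "laplace_transform (\<lambda>x. exp (- (x * a))) s = 1 / (s + a)"
proof -
  have "exp (- (x * s)) * exp (- (x * a)) = exp (- (x * (s + a)))" for x
    by (simp add: algebra_simps flip: exp_add)
  thus "set_integrable lborel {0<..} (\<lambda>x. exp (- (x * s)) * exp (- (x * a)))"
    and "laplace_transform (\<lambda>x. exp (- (x * a))) s = 1 / (s + a)"
    using integrable_I0i_exp_mscale[OF assms] LBINT_I0i_exp_mscale[OF assms]
    by (simp_all add: laplace_transform_def interval_lebesgue_integral_0_infty)
qed

lemma laplace_transform_cmult: "laplace_transform (\<lambda>x. c * f x) s = c * laplace_transform f s"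
  by (simp add: laplace_transform_def mult.left_commute)

lemma laplace_transform_exp_diff:
  assumes "s + a > 0" "s + b > 0"
  shows "set_integrable lborel {0<..} (\<lambda>x. exp (- (x * s)) * (exp (- (x * a)) - exp (- (x * b))))"
    and "laplace_transform (\<lambda>x. exp (- (x * a)) - exp (- (x * b))) s = 1 / (s + a) - 1 / (s + b)"
  using set_integral_diff[OF assms[THEN laplace_transform_exp(1)]]
    assms[THEN laplace_transform_exp(2)]
  by (simp_all add: laplace_transform_def right_diff_distrib)

lemma laplace_transform_bounded:
  assumes [measurable]: "f \<in> borel_measurable borel"
    and bound: "\<And>x. x > 0 \<Longrightarrow> \<bar>f x\<bar> \<le> B" and "s > 0"
  shows "set_integrable lborel {0<..} (\<lambda>x. exp (- (x * s)) * f x)"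
    and "\<bar>laplace_transform f s\<bar> \<le> B / s"
proof -
  have dominating: "set_integrable lborel {0<..} (\<lambda>x. exp (- (x * s)) * B)"
    using laplace_transform_exp(1)[of s 0] \<open>s > 0\<close> by simp
  show integrable: "set_integrable lborel {0<..} (\<lambda>x. exp (- (x * s)) * f x)"
  proof (rule set_integrable_bound[OF dominating])
    have "B \<ge> 0" using bound[of 1] by simp
    thus "AE x in lborel. x \<in> {0<..} \<longrightarrow>
        norm (exp (- (x * s)) * f x) \<le> norm (exp (- (x * s)) * B)"
      using bound by (simp add: abs_mult)
  qed (simp add: set_borel_measurable_def)
  have "\<bar>laplace_transform f s\<bar> \<le> (LBINT x:{0<..}. \<bar>exp (- (x * s)) * f x\<bar>)"
    using set_integral_norm_bound[OF integrable] by (simp add: laplace_transform_def)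
  also have "\<dots> \<le> (LBINT x:{0<..}. exp (- (x * s)) * B)"
    using bound by (intro set_integral_mono set_integrable_abs integrable dominating)
      (auto simp: abs_mult)
  also have "\<dots> = B / s"
    using laplace_transform_exp(2)[of s 0] \<open>s > 0\<close> by (simp add: laplace_transform_def)
  finally show "\<bar>laplace_transform f s\<bar> \<le> B / s" .
qed

lemma laplace_transform_suminf:
  assumes integrable: "\<And>j. set_integrable lborel {0<..} (\<lambda>x. exp (- (x * s)) * f j x)"
    and "summable (\<lambda>j. laplace_transform (\<lambda>x. \<bar>f j x\<bar>) s)"
    and pointwise: "\<And>x. x > 0 \<Longrightarrow> summable (\<lambda>j. \<bar>f j x\<bar>)"
  shows "(\<lambda>j. laplace_transform (f j) s) sums laplace_transform (\<lambda>x. \<Sum>j. f j x) s"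
proof -
  let ?F = "\<lambda>j x. indicator {0<..} x *\<^sub>R (exp (- (x * s)) * f j x)"
  have "summable (\<lambda>j. norm (?F j x))" for x
    using pointwise[of x] by (cases "x > 0") (auto simp: abs_mult intro: summable_mult)
  moreover have "summable (\<lambda>j. \<integral>x. norm (?F j x) \<partial>lborel)"
    using assms(2) by (simp add: laplace_transform_def set_lebesgue_integral_def abs_mult)
  ultimately have "(\<lambda>j. integral\<^sup>L lborel (?F j)) sums (\<integral>x. (\<Sum>j. ?F j x) \<partial>lborel)"
    using integrable by (intro sums_integral) (auto simp: set_integrable_def)
  moreover have "(\<Sum>j. ?F j x) = indicator {0<..} x *\<^sub>R (exp (- (x * s)) * (\<Sum>j. f j x))" for x
    using summable_rabs_cancel[OF pointwise[of x]] by (cases "x > 0") (auto simp: suminf_mult)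
  ultimately show ?thesis by (simp add: laplace_transform_def set_lebesgue_integral_def)
qed

lemma laplace_transform_geometric_sums:
  assumes [measurable]: "f \<in> borel_measurable borel"
    and bound: "\<And>x. x > 0 \<Longrightarrow> \<bar>f x\<bar> \<le> B" and "s > 0" "a > 0"
  shows "(\<lambda>r. laplace_transform (\<lambda>x. (1 - exp (- (x * a))) * f x) (s + real r * a)) sums
           laplace_transform f s"
proof -
  have shift: "laplace_transform (\<lambda>x. (1 - exp (- (x * a))) * f x) t =
      laplace_transform f t - laplace_transform f (t + a)" if "t > 0" for t
  proof -
    have "exp (- (x * t)) * ((1 - exp (- (x * a))) * f x) =
        exp (- (x * t)) * f x - exp (- (x * (t + a))) * f x" for x
      by (simp add: algebra_simps flip: exp_add)
    thus ?thesis unfolding laplace_transform_def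
      using set_integral_diff(2)[OF laplace_transform_bounded(1)[OF assms(1) bound that]
          laplace_transform_bounded(1)[OF assms(1) bound, of "t + a"]] that \<open>a > 0\<close>
      by simp
  qed
  have "(\<lambda>r. laplace_transform f (s + real r * a)) \<longlonglongrightarrow> 0"
  proof (rule Lim_null_comparison)
    show "\<forall>\<^sub>F r in sequentially. norm (laplace_transform f (s + real r * a)) \<le> B / (s + real r * a)"
      using laplace_transform_bounded(2)[OF assms(1) bound] \<open>s > 0\<close> \<open>a > 0\<close>
      by (simp add: add_pos_nonneg)
    show "(\<lambda>r. B / (s + real r * a)) \<longlonglongrightarrow> 0" using \<open>a > 0\<close> by real_asymp
  qed
  from telescope_sums'[OF this] show ?thesis
    using \<open>s > 0\<close> \<open>a > 0\<close> by (subst shift) (simp_all add: add_pos_nonneg add_ac distrib_right)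
qed

subsection \<open>The Laplace transform of Euler's function\<close>

lemma exp_minus_power: "exp (- x) ^ n = exp (- (x * real n))" for x :: real
  by (simp add: mult.commute flip: exp_of_nat_mult)

lemma pentagonal_term_exp:
  "pentagonal_term (exp (- x)) j = (-1) ^ j *
     (exp (- (x * pentagonal_number (- int j))) - exp (- (x * pentagonal_number (int j + 1))))"
  for x :: real
  by (simp add: pentagonal_term_def exp_minus_power)

lemma laplace_transform_pentagonal_term:
  fixes s :: real
  assumes "s > 0"
  shows "set_integrable lborel {0<..} (\<lambda>x. exp (- (x * s)) * pentagonal_term (exp (- x)) j)"
    and "laplace_transform (\<lambda>x. pentagonal_term (exp (- x)) j) s =
      (-1) ^ j * (1 / (s + pentagonal_number (- int j)) - 1 / (s + pentagonal_number (int j + 1)))"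
    and "laplace_transform (\<lambda>x. \<bar>pentagonal_term (exp (- x)) j\<bar>) s =
      1 / (s + pentagonal_number (- int j)) - 1 / (s + pentagonal_number (int j + 1))"
proof -
  define a b where "a = real (pentagonal_number (- int j))"
    and "b = real (pentagonal_number (int j + 1))"
  note difference = laplace_transform_exp_diff[of s a b]
  have pos: "s + a > 0" "s + b > 0" using assms by (simp_all add: a_def b_def add_pos_nonneg)
  show "set_integrable lborel {0<..} (\<lambda>x. exp (- (x * s)) * pentagonal_term (exp (- x)) j)"
    unfolding pentagonal_term_exp mult.left_commute[of _ "(-1) ^ j"]
    by (intro set_integrable_mult_right difference[unfolded a_def b_def] pos[unfolded a_def b_def])
  show "laplace_transform (\<lambda>x. pentagonal_term (exp (- x)) j) s =
      (-1) ^ j * (1 / (s + a) - 1 / (s + b))"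
    using difference(2)[OF pos]
    by (simp add: pentagonal_term_exp laplace_transform_cmult flip: a_def b_def)
  have "a \<le> b"
    using double_pentagonal_number[of "- int j"] double_pentagonal_number[of "int j + 1"]
    by (simp add: a_def b_def algebra_simps)
  hence "\<bar>pentagonal_term (exp (- x)) j\<bar> = exp (- (x * a)) - exp (- (x * b))"
    if "x > 0" for x :: real
    using that by (simp add: pentagonal_term_exp abs_mult flip: a_def b_def)
  thus "laplace_transform (\<lambda>x. \<bar>pentagonal_term (exp (- x)) j\<bar>) s = 1 / (s + a) - 1 / (s + b)"
    using difference(2)[OF pos] by (simp cong: laplace_transform_cong)
qed

definition euler_laplace :: "real \<Rightarrow> real" where
  "euler_laplace = laplace_transform (\<lambda>x. euler_function (exp (- x)))"

lemma euler_laplace_sums: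
  fixes s :: real
  assumes "s > 0"
  shows "(\<lambda>j. (-1) ^ j * (1 / (s + pentagonal_number (- int j)) -
           1 / (s + pentagonal_number (int j + 1)))) sums euler_laplace s"
proof -
  have "summable (\<lambda>j. laplace_transform (\<lambda>x. \<bar>pentagonal_term (exp (- x)) j\<bar>) s)"
  proof (rule summable_comparison_test')
    show "summable (\<lambda>j. inverse (real j ^ 2))" by (rule inverse_power_summable) simp
    fix j :: nat assume "j \<ge> 1"
    have "0 \<le> laplace_transform (\<lambda>x. \<bar>pentagonal_term (exp (- x)) j\<bar>) s"
      unfolding laplace_transform_def set_lebesgue_integral_def
      by (intro Bochner_Integration.integral_nonneg) auto
    moreover have "laplace_transform (\<lambda>x. \<bar>pentagonal_term (exp (- x)) j\<bar>) s \<le>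
        1 / (s + pentagonal_number (- int j))"
      using assms by (simp add: laplace_transform_pentagonal_term(3))
    moreover have "j\<^sup>2 \<le> pentagonal_number (- int j)"
      using square_le_pentagonal_number[of "- int j"] by simp
    hence "1 / (s + pentagonal_number (- int j)) \<le> 1 / real (j\<^sup>2)"
      using assms \<open>j \<ge> 1\<close> by (intro divide_left_mono) (auto simp del: of_nat_power)
    ultimately show "norm (laplace_transform (\<lambda>x. \<bar>pentagonal_term (exp (- x)) j\<bar>) s) \<le>
        inverse (real j ^ 2)"
      by (simp add: inverse_eq_divide)
  qed
  hence "(\<lambda>j. laplace_transform (\<lambda>x. pentagonal_term (exp (- x)) j) s) sums
      laplace_transform (\<lambda>x. \<Sum>j. pentagonal_term (exp (- x)) j) s"
    using summable_norm_pentagonal_term[of "exp (- x)" for x :: real]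
    by (intro laplace_transform_suminf laplace_transform_pentagonal_term(1) assms) auto
  also have "laplace_transform (\<lambda>x. \<Sum>j. pentagonal_term (exp (- x)) j) s = euler_laplace s"
    unfolding euler_laplace_def
    by (intro laplace_transform_cong pentagonal_number_theorem[symmetric]) simp
  finally show ?thesis unfolding laplace_transform_pentagonal_term(2)[OF assms] .
qed

lemma Im_pi_over_sin_one_sixth:
  "Im (of_real pi / sin (of_real pi * Complex (1 / 6) a)) =
     - (pi * sqrt 3 / 2 * sinh (pi * a) / ((sinh (pi * a))\<^sup>2 + 1 / 4))"
proof -
  have Re: "Re (sin (of_real pi * Complex (1 / 6) a)) = cosh (pi * a) / 2"
    by (simp add: Re_sin cosh_field_def sin_30)
  have Im: "Im (sin (of_real pi * Complex (1 / 6) a)) = sqrt 3 / 2 * sinh (pi * a)"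
    by (simp add: Im_sin sinh_field_def cos_30)
  have "(cosh (pi * a) / 2)\<^sup>2 + (sqrt 3 / 2 * sinh (pi * a))\<^sup>2 = (sinh (pi * a))\<^sup>2 + 1 / 4"
    by (simp add: power_divide power_mult_distrib cosh_square_eq add_divide_distrib)
  thus ?thesis
    unfolding Im_divide Re Im by (simp add: power2_eq_square)
qed

text \<open>Completing the square: \<open>s + k (3 k - 1) / 2 = (3 / 2) ((k - 1 / 6)\<^sup>2 + a\<^sup>2)\<close>.\<close>

lemma Im_inverse_one_sixth_minus_of_int:
  fixes a s :: real
  assumes "a\<^sup>2 = 2 * s / 3 - 1 / 36"
  shows "Im (1 / (Complex (1 / 6) a - of_int k)) = - (3 * a / 2) * (1 / (s + pentagonal_number k))"
proof -
  have "(1 / 6 - real_of_int k)\<^sup>2 + a\<^sup>2 = 2 / 3 * (s + pentagonal_number k)"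
    unfolding assms of_nat_pentagonal_number by (simp add: power2_eq_square field_simps)
  moreover have "Im (1 / (Complex (1 / 6) a - of_int k)) = - a / ((1 / 6 - real_of_int k)\<^sup>2 + a\<^sup>2)"
    by (simp add: Im_divide)
  ultimately show ?thesis by (simp only:) (simp add: field_simps)
qed

lemma Im_cosecant_term_one_sixth:
  fixes a s :: real
  assumes "a\<^sup>2 = 2 * s / 3 - 1 / 36"
  defines "z \<equiv> Complex (1 / 6) a"
  shows "Im ((-1) ^ n * (1 / (z + of_nat n) - 1 / (z - of_nat (Suc n)))) =
           - (3 * a / 2) * ((-1) ^ n * (1 / (s + pentagonal_number (- int n)) -
             1 / (s + pentagonal_number (int n + 1))))"
proof -
  have "Im ((-1) ^ n * w) = (-1) ^ n * Im w" for w
    by (induction n) simp_all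
  hence "Im ((-1) ^ n * (1 / (z + of_nat n) - 1 / (z - of_nat (Suc n)))) =
      (-1) ^ n * (Im (1 / (z - of_int (- int n))) - Im (1 / (z - of_int (int n + 1))))"
    by (simp add: add.commute)
  thus ?thesis
    unfolding z_def Im_inverse_one_sixth_minus_of_int[OF assms(1)] by (simp add: algebra_simps)
qed

theorem euler_laplace_closed_form:
  assumes "s > 1 / 24"
  defines "a \<equiv> sqrt (2 * s / 3 - 1 / 36)"
  shows "euler_laplace s =
           pi / sqrt 3 * (sinh (pi * a) / (a * ((sinh (pi * a))\<^sup>2 + 1 / 4)))"
proof -
  define T where "T = (sinh (pi * a))\<^sup>2 + 1 / 4"
  have a: "a > 0" "a\<^sup>2 = 2 * s / 3 - 1 / 36" using assms by simp_all
  have "Complex (1 / 6) a \<notin> \<int>"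
    using a by (auto simp: complex_eq_iff elim!: Ints_cases)
  from sums_Im[OF cosecant_partial_fractions[OF this]]
  have "(\<lambda>n. - (3 * a / 2) * ((-1) ^ n * (1 / (s + pentagonal_number (- int n)) -
      1 / (s + pentagonal_number (int n + 1))))) sums - (pi * sqrt 3 / 2 * sinh (pi * a) / T)"
    unfolding Im_pi_over_sin_one_sixth Im_cosecant_term_one_sixth[OF a(2)] T_def .
  moreover have "(\<lambda>n. - (3 * a / 2) * ((-1) ^ n * (1 / (s + pentagonal_number (- int n)) -
      1 / (s + pentagonal_number (int n + 1))))) sums (- (3 * a / 2) * euler_laplace s)"
    using assms by (intro sums_mult euler_laplace_sums) simp
  ultimately have imaginary_part:
    "3 * a / 2 * euler_laplace s = pi * sqrt 3 / 2 * sinh (pi * a) / T"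
    using sums_unique2 by fastforce
  have "euler_laplace s = 2 / (3 * a) * (3 * a / 2 * euler_laplace s)" using a(1) by simp
  also have "\<dots> = pi * (sqrt 3 / 3) * (sinh (pi * a) / (a * T))"
    unfolding imaginary_part by (simp add: mult_ac)
  also have "sqrt 3 / 3 = 1 / sqrt 3"
    by (simp add: field_simps)
  finally show ?thesis by (simp add: T_def)
qed

lemma sinh_quotient_asymp:
  "(\<lambda>y. sinh y / ((sinh y)\<^sup>2 + 1 / 4)) \<sim>[at_top] (\<lambda>y::real. 2 * exp (- y))"
  unfolding sinh_field_def by (rule asymp_equivI') (real_asymp simp: power_divide)

lemma sinh_quotient_sqrt_asymp:
  "(\<lambda>u. sinh (pi * sqrt (u - 1 / 36)) /
      (sqrt (u - 1 / 36) * ((sinh (pi * sqrt (u - 1 / 36)))\<^sup>2 + 1 / 4))) \<sim>[at_top]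
   (\<lambda>u. 2 * exp (- (pi * sqrt u)) / sqrt u)"
proof -
  have "filterlim (\<lambda>u. pi * sqrt (u - 1 / 36)) at_top at_top" by real_asymp
  from asymp_equiv_divide[OF asymp_equiv_compose'[OF sinh_quotient_asymp this] asymp_equiv_refl]
  have "(\<lambda>u. sinh (pi * sqrt (u - 1 / 36)) / ((sinh (pi * sqrt (u - 1 / 36)))\<^sup>2 + 1 / 4) /
        sqrt (u - 1 / 36)) \<sim>[at_top]
      (\<lambda>u. 2 * exp (- (pi * sqrt (u - 1 / 36))) / sqrt (u - 1 / 36))" .
  also have "\<dots> \<sim>[at_top] (\<lambda>u. 2 * exp (- (pi * sqrt u)) / sqrt u)"
    by (rule asymp_equivI') real_asymp
  finally show ?thesis by (simp add: mult.commute)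
qed

theorem euler_laplace_asymp:
  "(\<lambda>s. s * euler_laplace s) \<sim>[at_top]
     (\<lambda>s. pi * sqrt (2 * s) * exp (- pi * sqrt (2 / 3) * sqrt s))"
    (is "?L \<sim>[at_top] ?R")
proof -
  let ?a = "\<lambda>s. sqrt (2 * s / 3 - 1 / 36)"
  have "filterlim (\<lambda>s::real. 2 * s / 3) at_top at_top" by real_asymp
  hence "(\<lambda>s. s * (pi / sqrt 3) * (sinh (pi * ?a s) / (?a s * ((sinh (pi * ?a s))\<^sup>2 + 1 / 4))))
      \<sim>[at_top] (\<lambda>s. s * (pi / sqrt 3) * (2 * exp (- (pi * sqrt (2 * s / 3))) / sqrt (2 * s / 3)))"
    by (intro asymp_equiv_mult asymp_equiv_refl asymp_equiv_compose'[OF sinh_quotient_sqrt_asymp])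
  thus ?thesis
  proof (rule asymp_equiv_transfer)
    show "\<forall>\<^sub>F s in at_top. s * (pi / sqrt 3) *
        (sinh (pi * ?a s) / (?a s * ((sinh (pi * ?a s))\<^sup>2 + 1 / 4))) = ?L s"
      using eventually_gt_at_top[of "1 / 24"]
      by eventually_elim (simp add: euler_laplace_closed_form)
    show "\<forall>\<^sub>F s in at_top. s * (pi / sqrt 3) *
        (2 * exp (- (pi * sqrt (2 * s / 3))) / sqrt (2 * s / 3)) = ?R s"
      using eventually_gt_at_top[of 0]
    proof eventually_elim
      case (elim s)
      have "s * (pi / sqrt 3) * (2 * exp (- (pi * sqrt (2 * s / 3))) / sqrt (2 * s / 3)) =
          pi * (2 * s / (sqrt 3 * sqrt (2 * s / 3))) * exp (- (pi * sqrt (2 * s / 3)))"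
        by simp
      also have "2 * s / (sqrt 3 * sqrt (2 * s / 3)) = sqrt (2 * s)"
        using elim real_div_sqrt[of "2 * s"] by (simp flip: real_sqrt_mult)
      also have "pi * sqrt (2 * s) * exp (- (pi * sqrt (2 * s / 3))) = ?R s"
        by (simp add: mult.assoc flip: real_sqrt_mult)
      finally show ?case .
    qed
  qed
qed

lemma suminf_multiples_bigo:
  fixes f g :: "real \<Rightarrow> real"
  assumes "f \<in> O(\<lambda>s. g s / s\<^sup>2)"
    and antimono: "\<And>s t. 0 < s \<Longrightarrow> s \<le> t \<Longrightarrow> g t \<le> g s" and nonneg: "\<And>s. 0 \<le> g s" and "k > 0"
  shows "(\<lambda>x. \<Sum>r. f (real (r + k) * x)) \<in> O(\<lambda>x. g (real k * x) / x\<^sup>2)"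
proof -
  obtain C where "C > 0" and "\<forall>\<^sub>F s in at_top. norm (f s) \<le> C * norm (g s / s\<^sup>2)"
    using landau_o.bigE[OF assms(1)] by blast
  then obtain s0 where bound: "\<And>s. s \<ge> s0 \<Longrightarrow> \<bar>f s\<bar> \<le> C * (g s / s\<^sup>2)"
    unfolding eventually_at_top_linorder using nonneg by auto
  have summable: "summable (\<lambda>r. inverse (real (r + k) ^ 2))"
    by (rule summable_ignore_initial_segment) (rule inverse_power_summable, simp)
  define D where "D = C * (\<Sum>r. inverse (real (r + k) ^ 2))"
  have "\<bar>\<Sum>r. f (real (r + k) * x)\<bar> \<le> D * (g (real k * x) / x\<^sup>2)"
    if x: "x \<ge> max s0 1" for x
  proof -
    have "norm (f (real (r + k) * x)) \<le>
        C * (g (real k * x) / x\<^sup>2) * inverse (real (r + k) ^ 2)" for r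
    proof -
      have "x \<le> real (r + k) * x"
        using x \<open>k > 0\<close> mult_right_mono[of 1 "real (r + k)" x] by simp
      hence "\<bar>f (real (r + k) * x)\<bar> \<le> C * (g (real (r + k) * x) / (real (r + k) * x)\<^sup>2)"
        using x by (intro bound) linarith
      also have "\<dots> \<le> C * (g (real k * x) / (real (r + k) * x)\<^sup>2)"
        using x \<open>k > 0\<close> \<open>C > 0\<close>
        by (intro mult_left_mono divide_right_mono antimono mult_right_mono) auto
      finally show ?thesis by (simp add: power_mult_distrib divide_inverse mult_ac)
    qed
    from norm_suminf_le[OF this summable_mult[OF summable]] show ?thesis
      unfolding suminf_mult[OF summable] by (simp add: D_def mult_ac)
  qed
  thus ?thesis using nonneg
    by (intro bigoI[of _ D] eventually_at_top_linorderI[of "max s0 1"]) auto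
qed

lemma suminf_euler_laplace_smallo:
  "(\<lambda>m. real m * (\<Sum>r. euler_laplace (real (r + 2) * real m))) \<in>
     o(\<lambda>m. pi * sqrt (2 * real m) * exp (- pi * sqrt (2 / 3) * sqrt (real m)))"
proof -
  define c where "c = pi * sqrt (2 / 3)"
  define b where "b = 3 / 4 * c" \<comment> \<open>any rate strictly between \<open>c / sqrt 2\<close> and \<open>c\<close> works\<close>
  have "c > 0" by (simp add: c_def)
  have "4 / 3 < sqrt 2" by (rule real_less_rsqrt) (simp add: power2_eq_square)
  hence b: "0 < b" "b < c" "c < b * sqrt 2" using \<open>c > 0\<close> by (simp_all add: b_def)
  define d where "d = b * sqrt 2"
  have "(\<lambda>s. s * euler_laplace s) \<in> O(\<lambda>s. pi * sqrt (2 * s) * exp (- c * sqrt s))"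
    using asymp_equiv_imp_bigo[OF euler_laplace_asymp] by (simp add: c_def)
  also have "(\<lambda>s. pi * sqrt (2 * s) * exp (- c * sqrt s)) \<in> O(\<lambda>s. s * (exp (- b * sqrt s) / s\<^sup>2))"
    using b by real_asymp
  finally have "euler_laplace \<in> O(\<lambda>s. exp (- b * sqrt s) / s\<^sup>2)"
    by (subst (asm) landau_o.big.mult_cancel_left)
       (auto intro: eventually_mono[OF eventually_gt_at_top[of 0]])
  hence "(\<lambda>x. \<Sum>r. euler_laplace (real (r + 2) * x)) \<in> O(\<lambda>x. exp (- b * sqrt (real 2 * x)) / x\<^sup>2)"
    using b(1) by (intro suminf_multiples_bigo) auto
  hence "(\<lambda>x. x * (\<Sum>r. euler_laplace (real (r + 2) * x))) \<in> O(\<lambda>x. x * (exp (- d * sqrt x) / x\<^sup>2))"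
    by (intro landau_o.big.mult_left) (simp add: d_def real_sqrt_mult mult_ac)
  also have "(\<lambda>x. x * (exp (- d * sqrt x) / x\<^sup>2)) \<in> o(\<lambda>x. pi * sqrt (2 * x) * exp (- c * sqrt x))"
    using b(3)[folded d_def] \<open>c > 0\<close> by real_asymp
  finally show ?thesis
    using landau_o.small.compose[OF _ filterlim_real_sequentially] by (simp add: c_def)
qed

subsection \<open>The maximum of independent exponential variables\<close>

context prob_space
begin

lemma prob_all_le_eq_prod:
  fixes X :: "'i \<Rightarrow> 'a \<Rightarrow> real"
  assumes "indep_vars (\<lambda>_. borel) X I" and "finite J" "J \<subseteq> I"
  shows "\<P>(\<omega> in M. \<forall>j\<in>J. X j \<omega> \<le> x) = (\<Prod>j\<in>J. \<P>(\<omega> in M. X j \<omega> \<le> x))"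
proof (cases "J = {}")
  case False
  hence "{\<omega> \<in> space M. \<forall>j\<in>J. X j \<omega> \<le> x} = (\<Inter>j\<in>J. X j -` {..x} \<inter> space M)" by auto
  also have "prob \<dots> = (\<Prod>j\<in>J. prob (X j -` {..x} \<inter> space M))"
    using assms False by (intro indep_varsD) auto
  also have "\<dots> = (\<Prod>j\<in>J. \<P>(\<omega> in M. X j \<omega> \<le> x))"
    by (intro prod.cong arg_cong[where f = prob]) auto
  finally show ?thesis .
qed (simp add: prob_space)

lemma indep_var_prob_Pair:
  assumes "indep_var S X T Y" and E [measurable]: "E \<in> sets (S \<Otimes>\<^sub>M T)"
  shows "\<P>(\<omega> in M. (X \<omega>, Y \<omega>) \<in> E) = expectation (\<lambda>\<omega>. \<P>(\<omega>' in M. (X \<omega>, Y \<omega>') \<in> E))"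
proof -
  have X [measurable]: "X \<in> M \<rightarrow>\<^sub>M S" and Y [measurable]: "Y \<in> M \<rightarrow>\<^sub>M T"
    and joint: "distr M S X \<Otimes>\<^sub>M distr M T Y = distr M (S \<Otimes>\<^sub>M T) (\<lambda>\<omega>. (X \<omega>, Y \<omega>))"
    using assms(1) by (auto simp: indep_var_distribution_eq)
  interpret Y: prob_space "distr M T Y" by (rule prob_space_distr[OF Y])
  have E': "E \<in> sets (distr M S X \<Otimes>\<^sub>M distr M T Y)" by (simp cong: sets_pair_measure_cong)
  have slice: "emeasure (distr M T Y) (Pair x -` E) = ennreal (\<P>(\<omega>' in M. (x, Y \<omega>') \<in> E))" for x
    by (auto simp: emeasure_distr sets_Pair1 emeasure_eq_measure intro!: arg_cong[where f = prob])
  have "ennreal (\<P>(\<omega> in M. (X \<omega>, Y \<omega>) \<in> E)) = emeasure (distr M S X \<Otimes>\<^sub>M distr M T Y) E"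
    by (auto simp: joint emeasure_distr emeasure_eq_measure intro!: arg_cong[where f = prob])
  also have "\<dots> = (\<integral>\<^sup>+x. emeasure (distr M T Y) (Pair x -` E) \<partial>distr M S X)"
    by (rule Y.emeasure_pair_measure_alt[OF E'])
  also have "\<dots> = (\<integral>\<^sup>+\<omega>. ennreal (\<P>(\<omega>' in M. (X \<omega>, Y \<omega>') \<in> E)) \<partial>M)"
    using Y.measurable_emeasure_Pair[OF E'] by (subst nn_integral_distr[OF X]) (auto simp: slice)
  finally have nn_integral: "ennreal (\<P>(\<omega> in M. (X \<omega>, Y \<omega>) \<in> E)) = \<dots>" .
  have "(\<lambda>\<omega>. enn2real (emeasure (distr M T Y) (Pair (X \<omega>) -` E))) \<in> borel_measurable M"
    using measurable_compose[OF X] Y.measurable_emeasure_Pair[OF E'] by simp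
  thus ?thesis
    by (subst integral_eq_nn_integral) (auto simp: slice nn_integral[symmetric])
qed

lemma sets_all_le:
  fixes X :: "'i :: countable \<Rightarrow> 'a \<Rightarrow> real"
  assumes [measurable]: "\<And>j. j \<in> J \<Longrightarrow> random_variable borel (X j)"
  shows "{\<omega> \<in> space M. \<forall>j\<in>J. X j \<omega> \<le> x} \<in> events"
  by measurable

lemma mono_prob_all_le:
  fixes X :: "'i :: countable \<Rightarrow> 'a \<Rightarrow> real"
  assumes "\<And>j. j \<in> J \<Longrightarrow> random_variable borel (X j)"
  shows "mono (\<lambda>x. \<P>(\<omega> in M. \<forall>j\<in>J. X j \<omega> \<le> x))"
proof (rule monoI)
  fix x y :: real assume "x \<le> y"
  thus "\<P>(\<omega> in M. \<forall>j\<in>J. X j \<omega> \<le> x) \<le> \<P>(\<omega> in M. \<forall>j\<in>J. X j \<omega> \<le> y)"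
    by (intro finite_measure_mono sets_all_le assms) force+
qed

lemma prob_all_le_eq_expectation:
  fixes X :: "'i :: countable \<Rightarrow> 'a \<Rightarrow> real"
  assumes "indep_vars (\<lambda>_. borel) X I" and "i \<in> I" "J \<subseteq> I" "i \<notin> J"
  shows "\<P>(\<omega> in M. \<forall>j\<in>J. X j \<omega> \<le> X i \<omega>) =
    expectation (\<lambda>\<omega>. \<P>(\<omega>' in M. \<forall>j\<in>J. X j \<omega>' \<le> X i \<omega>))"
proof -
  define N where "N K = PiM K (\<lambda>_. borel :: real measure)" for K :: "'i set"
  have component: "(\<lambda>f. f j) \<in> borel_measurable (N K)" if "j \<in> K" for j K
    unfolding N_def using that by (rule measurable_component_singleton)
  note [measurable] = component[of i "{i}", simplified] component[of _ J]
  define E where "E = {p \<in> space (N {i} \<Otimes>\<^sub>M N J). \<forall>j\<in>J. snd p j \<le> fst p i}"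
  have "E \<in> sets (N {i} \<Otimes>\<^sub>M N J)" unfolding E_def by measurable
  moreover have "indep_var (N {i}) (\<lambda>\<omega>. \<lambda>j\<in>{i}. X j \<omega>) (N J) (\<lambda>\<omega>. \<lambda>j\<in>J. X j \<omega>)"
    unfolding N_def using assms by (intro indep_var_restrict) auto
  ultimately show ?thesis
    by (auto dest!: indep_var_prob_Pair simp: E_def N_def space_pair_measure space_PiM)
qed

lemma prob_all_le_insert:
  fixes X :: "'i :: countable \<Rightarrow> 'a \<Rightarrow> real"
  assumes "indep_vars (\<lambda>_. borel) X I" and "i \<in> I" "J \<subseteq> I" "i \<notin> J"
  shows "\<P>(\<omega> in M. \<forall>j\<in>insert i J. X j \<omega> \<le> x) =
    \<P>(\<omega> in M. X i \<omega> \<le> x) * \<P>(\<omega> in M. \<forall>j\<in>J. X j \<omega> \<le> x)"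
proof -
  define B where "B K = {f \<in> space (PiM K (\<lambda>_. borel)). \<forall>j\<in>K. f j \<le> x}" for K :: "'i set"
  have "B K \<in> sets (PiM K (\<lambda>_. borel))" for K unfolding B_def by measurable
  moreover have "indep_var (PiM {i} (\<lambda>_. borel)) (\<lambda>\<omega>. \<lambda>j\<in>{i}. X j \<omega>)
      (PiM J (\<lambda>_. borel)) (\<lambda>\<omega>. \<lambda>j\<in>J. X j \<omega>)"
    using assms by (intro indep_var_restrict) auto
  ultimately have "prob ((\<lambda>\<omega>. (\<lambda>j\<in>{i}. X j \<omega>, \<lambda>j\<in>J. X j \<omega>)) -` (B {i} \<times> B J) \<inter> space M) =
      prob ((\<lambda>\<omega>. \<lambda>j\<in>{i}. X j \<omega>) -` B {i} \<inter> space M) * prob ((\<lambda>\<omega>. \<lambda>j\<in>J. X j \<omega>) -` B J \<inter> space M)"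
    by (intro indep_varD)
  moreover have "(\<lambda>\<omega>. (\<lambda>j\<in>{i}. X j \<omega>, \<lambda>j\<in>J. X j \<omega>)) -` (B {i} \<times> B J) \<inter> space M =
      {\<omega> \<in> space M. \<forall>j\<in>insert i J. X j \<omega> \<le> x}"
    by (auto simp: B_def space_PiM)
  moreover have event: "(\<lambda>\<omega>. \<lambda>j\<in>K. X j \<omega>) -` B K \<inter> space M = {\<omega> \<in> space M. \<forall>j\<in>K. X j \<omega> \<le> x}" for K
    by (auto simp: B_def space_PiM)
  ultimately show ?thesis unfolding event by simp
qed

lemma expectation_exponential:
  assumes "distributed M lborel Y (exponential_density l)" and "l > 0"
    and [measurable]: "g \<in> borel_measurable borel"
  shows "expectation (\<lambda>\<omega>. g (Y \<omega>)) = l * laplace_transform g l"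
proof -
  have "expectation (\<lambda>\<omega>. g (Y \<omega>)) = (\<integral>x. exponential_density l x * g x \<partial>lborel)"
    using assms(2)
    by (intro distributed_integral[OF assms(1), symmetric]) (auto simp: exponential_density_nonneg)
  also have "\<dots> = (\<integral>x. l * (indicator {0<..} x *\<^sub>R (exp (- (x * l)) * g x)) \<partial>lborel)"
  proof (rule integral_cong_AE)
    show "AE x in lborel. exponential_density l x * g x =
        l * (indicator {0<..} x *\<^sub>R (exp (- (x * l)) * g x))"
      using AE_lborel_singleton[of 0]
      by eventually_elim (auto simp: exponential_density_def indicator_def)
  qed auto
  also have "\<dots> = l * laplace_transform g l"
    by (simp add: laplace_transform_def set_lebesgue_integral_def)
  finally show ?thesis .
qed

end

lemma eq_SUP_iff_upper_bound:
  fixes f :: "'i \<Rightarrow> 'a :: complete_lattice"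
  assumes "i \<in> I"
  shows "f i = (SUP j\<in>I. f j) \<longleftrightarrow> (\<forall>j\<in>I. f j \<le> f i)"
  using assms by (auto intro!: antisym SUP_least intro: SUP_upper)

locale independent_exponentials = prob_space +
  fixes X :: "nat \<Rightarrow> 'a \<Rightarrow> real"
  assumes indep: "indep_vars (\<lambda>_. borel) X {1..}"
    and exponential: "i \<ge> 1 \<Longrightarrow> distributed M lborel (X i) (exponential_density (real i))"
begin

lemma measurable_X: "i \<ge> 1 \<Longrightarrow> random_variable borel (X i)"
  using indep by (simp add: indep_vars_def)

lemma prob_X_le:
  assumes "x \<ge> 0" "i \<ge> 1"
  shows "\<P>(\<omega> in M. X i \<omega> \<le> x) = 1 - exp (- x) ^ i"
  using exponential_distributedD_le[OF exponential[OF assms(2)] assms(1)] assms(2)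
  by (simp add: exp_minus_power)

lemma prob_all_X_le:
  assumes "x > 0"
  shows "\<P>(\<omega> in M. \<forall>i\<in>{1..}. X i \<omega> \<le> x) = euler_function (exp (- x))"
proof (rule LIMSEQ_unique)
  define A where "A n = {\<omega> \<in> space M. \<forall>i\<in>{1..n}. X i \<omega> \<le> x}" for n
  have "(\<lambda>n. prob (A n)) \<longlonglongrightarrow> prob (\<Inter>n. A n)"
  proof (rule finite_Lim_measure_decseq)
    show "range A \<subseteq> events"
      unfolding A_def by (auto intro!: sets_all_le measurable_X)
  qed (auto simp: decseq_def A_def)
  also have "(\<Inter>n. A n) = {\<omega> \<in> space M. \<forall>i\<in>{1..}. X i \<omega> \<le> x}"
    by (auto simp: A_def) (metis atLeastAtMost_iff order_refl)
  finally show "(\<lambda>n. prob (A n)) \<longlonglongrightarrow> \<P>(\<omega> in M. \<forall>i\<in>{1..}. X i \<omega> \<le> x)" .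
  have "prob (A n) = (\<Prod>i\<in>{1..n}. 1 - exp (- x) ^ i)" for n
    unfolding A_def using assms
    by (subst prob_all_le_eq_prod[OF indep]) (auto intro!: prod.cong prob_X_le)
  hence "prob (A n) = (\<Prod>i<n. 1 - exp (- x) ^ Suc i)" for n
    by (simp add: prod.atLeast1_atMost_eq del: power_Suc)
  thus "(\<lambda>n. prob (A n)) \<longlonglongrightarrow> euler_function (exp (- x))"
    using assms has_prod_imp_tendsto'[OF has_prod_euler_function[of "exp (- x)"]] by simp
qed

lemma prob_X_eq_SUP:
  assumes "m \<ge> 1"
  shows "\<P>(\<omega> in M. ereal (X m \<omega>) = (SUP i\<in>{1..}. ereal (X i \<omega>))) =
    m * laplace_transform (\<lambda>x. \<P>(\<omega> in M. \<forall>i\<in>{1..} - {m}. X i \<omega> \<le> x)) m"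
proof -
  have "ereal (X m \<omega>) = (SUP i\<in>{1..}. ereal (X i \<omega>)) \<longleftrightarrow> (\<forall>i\<in>{1..} - {m}. X i \<omega> \<le> X m \<omega>)" for \<omega>
    using eq_SUP_iff_upper_bound[of m "{1..}" "\<lambda>i. ereal (X i \<omega>)"] assms by auto
  hence "\<P>(\<omega> in M. ereal (X m \<omega>) = (SUP i\<in>{1..}. ereal (X i \<omega>))) =
      expectation (\<lambda>\<omega>. \<P>(\<omega>' in M. \<forall>i\<in>{1..} - {m}. X i \<omega>' \<le> X m \<omega>))"
    using prob_all_le_eq_expectation[OF indep, of m "{1..} - {m}"] assms by simp
  also have "\<dots> = m * laplace_transform (\<lambda>x. \<P>(\<omega> in M. \<forall>i\<in>{1..} - {m}. X i \<omega> \<le> x)) m"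
    using assms exponential
    by (intro expectation_exponential borel_measurable_mono mono_prob_all_le measurable_X) auto
  finally show ?thesis .
qed

theorem prob_X_eq_SUP_series:
  assumes "m \<ge> 1"
  shows "\<P>(\<omega> in M. ereal (X m \<omega>) = (SUP i\<in>{1..}. ereal (X i \<omega>))) =
    m * euler_laplace m + m * (\<Sum>r. euler_laplace (real (r + 2) * m))"
proof -
  let ?G = "\<lambda>x. \<P>(\<omega> in M. \<forall>i\<in>{1..} - {m}. X i \<omega> \<le> x)"
  have "insert m ({1..} - {m}) = {1..}" using assms by auto
  hence "(1 - exp (- (x * m))) * ?G x = euler_function (exp (- x))" if "x > 0" for x :: real
    using prob_all_le_insert[OF indep, of m "{1..} - {m}" x] prob_all_X_le[OF that]
      prob_X_le[of x m] that assms by (simp add: exp_minus_power)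
  hence "laplace_transform (\<lambda>x. (1 - exp (- (x * m))) * ?G x) s = euler_laplace s" for s
    unfolding euler_laplace_def by (intro laplace_transform_cong)
  moreover have "(\<lambda>r. laplace_transform (\<lambda>x. (1 - exp (- (x * m))) * ?G x) (m + real r * m)) sums
      laplace_transform ?G m"
    using assms
    by (intro laplace_transform_geometric_sums[where B = 1] borel_measurable_mono
        mono_prob_all_le measurable_X) auto
  ultimately have sums: "(\<lambda>r. euler_laplace (m + real r * m)) sums laplace_transform ?G m" by simp
  have "m + real (Suc r) * m = real (r + 2) * m" for r by (simp add: distrib_right)
  hence "laplace_transform ?G m = euler_laplace m + (\<Sum>r. euler_laplace (real (r + 2) * m))"
    using suminf_split_head[OF sums_summable[OF sums]] sums_unique[OF sums] by simp
  thus ?thesis unfolding prob_X_eq_SUP[OF assms] by (simp add: distrib_left)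
qed

end

theorem theorem6:
  fixes M :: "'a measure" and X :: "nat \<Rightarrow> 'a \<Rightarrow> real"
  assumes "prob_space M"
    and "prob_space.indep_vars M (\<lambda>_. borel) X {1..}"
    and "\<And>i. i \<ge> 1 \<Longrightarrow> distributed M lborel (X i) (exponential_density (real i))"
  shows "(\<lambda>m::nat. measure M {\<omega> \<in> space M. ereal (X m \<omega>) = (SUP i\<in>{1..}. ereal (X i \<omega>))})
           \<sim>[at_top] (\<lambda>m. pi * sqrt (2 * real m) * exp (- pi * sqrt (2/3) * sqrt (real m)))"
proof -
  interpret independent_exponentials M X
    using assms by (intro independent_exponentials.intro independent_exponentials_axioms.intro)
  have "(\<lambda>m. real m * euler_laplace (real m) + real m * (\<Sum>r. euler_laplace (real (r + 2) * real m)))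
     \<sim>[at_top] (\<lambda>m. pi * sqrt (2 * real m) * exp (- pi * sqrt (2/3) * sqrt (real m)))"
    using asymp_equiv_compose'[OF euler_laplace_asymp filterlim_real_sequentially]
      suminf_euler_laplace_smallo
    by (simp add: asymp_equiv_add_right)
  moreover have "\<forall>\<^sub>F m in at_top.
      real m * euler_laplace (real m) + real m * (\<Sum>r. euler_laplace (real (r + 2) * real m)) =
      prob {\<omega> \<in> space M. ereal (X m \<omega>) = (SUP i\<in>{1..}. ereal (X i \<omega>))}"
    using eventually_ge_at_top[of 1] by eventually_elim (rule prob_X_eq_SUP_series[symmetric])
  ultimately show ?thesis by (rule asymp_equiv_transfer) simp
qed

end
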